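(* Let $\mathcal{H}$ be a $d$-dimensional complex Hilbert space, let $\mathbb{B}=\{\mathcal{B}_1,\ldots,\mathcal{B}_M\}$ be a set of $M\ge 1$ mutually unbiased bases in $\mathcal{H}$, let $\alpha\in[2,\infty)$, and let $\rho$ be an arbitrary density matrix on $\mathcal{H}$. Then the Rényi entropies satisfy the state-dependent bound $$\frac{1}{M}\sum_{\mathcal{B}\in\mathbb{B}}R_\alpha(\mathcal{B}|\rho)\;\ge\;\frac{\alpha}{2(\alpha-1)}\,\ln\!\left(\frac{Md}{\mathrm{tr}(\rho^2)\,d+M-1}\right),$$ and the state-independent bound $$\frac{1}{M}\sum_{\mathcal{B}\in\mathbb{B}}R_\alpha(\mathcal{B}|\rho)\;\ge\;\frac{\alpha}{2(\alpha-1)}\,\ln\!\left(\frac{Md}{d+M-1}\right).$$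
   Context: A density matrix on $\mathcal{H}$ is a positive semidefinite operator of trace $1$. Orthonormal bases $\{|b_j\rangle\}$ and $\{|c_k\rangle\}$ of $\mathcal{H}$ are mutually unbiased if $|\langle b_j|c_k\rangle|=1/\sqrt d$ for all $j,k$; a set of bases is a set of mutually unbiased bases (MUBs) if any two different bases in it are mutually unbiased. For a probability distribution $p=\{p_j\}$ and $\alpha>0$, $\alpha\ne 1$, the Rényi $\alpha$-entropy is $R_\alpha(p)=\frac{1}{1-\alpha}\ln\bigl(\sum_j p_j^\alpha\bigr)$. For an orthonormal basis $\mathcal{B}=\{|b_j\rangle\}_{j=1}^d$, $R_\alpha(\mathcal{B}|\rho)$ denotes $R_\alpha$ of the distribution $p_j(\mathcal{B}|\rho)=\langle b_j|\rho|b_j\rangle$. *)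

theory Defs
  imports "HOL-Analysis.Analysis"
begin

text \<open>The inner product is linear in the second argument, as in Dirac notation:
  \<open>cinner x y\<close> is \<open>\<langle>x|y\<rangle>\<close>. A finite-dimensional space of this class is a Hilbert space,
  completeness being automatic.\<close>

class complex_inner = ab_group_add +
  fixes scaleC :: "complex \<Rightarrow> 'a \<Rightarrow> 'a" (infixr "*\<^sub>C" 75)
    and cinner :: "'a \<Rightarrow> 'a \<Rightarrow> complex"
  assumes scaleC_add_right: "c *\<^sub>C (x + y) = c *\<^sub>C x + c *\<^sub>C y"
    and scaleC_add_left: "(c + c') *\<^sub>C x = c *\<^sub>C x + c' *\<^sub>C x"
    and scaleC_scaleC: "c *\<^sub>C (c' *\<^sub>C x) = (c * c') *\<^sub>C x"
    and scaleC_one: "1 *\<^sub>C x = x"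
    and cinner_commute: "cinner x y = cnj (cinner y x)"
    and cinner_add_right: "cinner x (y + z) = cinner x y + cinner x z"
    and cinner_scaleC_right: "cinner x (c *\<^sub>C y) = c * cinner x y"
    and cinner_ge_zero: "0 \<le> Re (cinner x x)"
    and cinner_eq_zero: "cinner x x = 0 \<Longrightarrow> x = 0"

global_interpretation complex_vector: vector_space "scaleC :: complex \<Rightarrow> 'a \<Rightarrow> 'a::complex_inner"
  defines cspan = "complex_vector.span"
    and cdependent = "complex_vector.dependent"
    and cdim = "complex_vector.dim"
  by unfold_locales (rule scaleC_add_right scaleC_add_left scaleC_scaleC scaleC_one)+

global_interpretation complex_vector_pair: vector_space_pair
    "scaleC :: complex \<Rightarrow> 'a \<Rightarrow> 'a::complex_inner" "scaleC :: complex \<Rightarrow> 'b \<Rightarrow> 'b::complex_inner"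
  by unfold_locales

abbreviation clinear :: "('a::complex_inner \<Rightarrow> 'b::complex_inner) \<Rightarrow> bool" where
  "clinear \<equiv> Vector_Spaces.linear scaleC scaleC"

text \<open>The library's \<open>dim\<close> is \<open>0\<close> on infinite-dimensional spaces, so finiteness needs its own
  predicate.\<close>

definition finite_dimensional :: "'a::complex_inner itself \<Rightarrow> bool" where
  "finite_dimensional _ \<longleftrightarrow> (\<exists>S::'a set. finite S \<and> cspan S = UNIV)"

definition orthonormal_basis :: "'a::complex_inner set \<Rightarrow> bool" where
  "orthonormal_basis B \<longleftrightarrow>
     (\<forall>b\<in>B. \<forall>c\<in>B. cinner b c = (if b = c then 1 else 0)) \<and> cspan B = UNIV"

text \<open>The choice of the basis is immaterial, see \<open>ctrace_eq\<close> below.\<close>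

definition ctrace :: "('a::complex_inner \<Rightarrow> 'a) \<Rightarrow> complex" where
  "ctrace A = (\<Sum>b\<in>(SOME B. orthonormal_basis B). cinner b (A b))"

definition positive_semidefinite :: "('a::complex_inner \<Rightarrow> 'a) \<Rightarrow> bool" where
  "positive_semidefinite A \<longleftrightarrow>
     clinear A \<and> (\<forall>x. cinner x (A x) \<in> \<real> \<and> 0 \<le> Re (cinner x (A x)))"

definition density_matrix :: "('a::complex_inner \<Rightarrow> 'a) \<Rightarrow> bool" where
  "density_matrix \<rho> \<longleftrightarrow> positive_semidefinite \<rho> \<and> ctrace \<rho> = 1"

lemma cinner_zero_right: "cinner x 0 = 0"
  using cinner_add_right[of x 0 0] by simp

lemma cinner_sum_right: "cinner x (\<Sum>i\<in>I. f i) = (\<Sum>i\<in>I. cinner x (f i))"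
  by (induction I rule: infinite_finite_induct) (simp_all add: cinner_zero_right cinner_add_right)

lemma orthonormal_basis_independent:
  assumes "orthonormal_basis B"
  shows "\<not> cdependent B"
proof
  assume "cdependent B"
  then obtain t u v where t: "finite t" "t \<subseteq> B" "(\<Sum>w\<in>t. u w *\<^sub>C w) = 0" "v \<in> t" "u v \<noteq> 0"
    unfolding complex_vector.dependent_explicit by blast
  have "cinner v (\<Sum>w\<in>t. u w *\<^sub>C w) = (\<Sum>w\<in>t. if w = v then u w else 0)"
    unfolding cinner_sum_right cinner_scaleC_right
  proof (intro sum.cong refl)
    fix w assume "w \<in> t"
    then have "w \<in> B" "v \<in> B" using t by auto
    then show "u w * cinner v w = (if w = v then u w else 0)"
      using assms by (auto simp: orthonormal_basis_def)
  qed
  also have "\<dots> = u v" using t by simp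
  finally show False using t by (simp add: cinner_zero_right)
qed

lemma orthonormal_basis_finite:
  fixes B :: "'a::complex_inner set"
  assumes "finite_dimensional TYPE('a)" "orthonormal_basis B"
  shows "finite B"
proof -
  obtain S :: "'a set" where "finite S" "cspan S = UNIV"
    using assms(1) unfolding finite_dimensional_def by blast
  with complex_vector.independent_span_bound[OF _ orthonormal_basis_independent[OF assms(2)], of S]
  show ?thesis by auto
qed

lemma orthonormal_basis_expansion:
  fixes B :: "'a::complex_inner set"
  assumes fin: "finite B" and B: "orthonormal_basis B"
  shows "x = (\<Sum>b\<in>B. cinner b x *\<^sub>C b)"
proof -
  have "x \<in> cspan B" using B by (simp add: orthonormal_basis_def)
  then show ?thesis
  proof (induction rule: complex_vector.span_induct_alt)
    case base
    show ?case by (simp add: cinner_zero_right)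
  next
    case (step c a y)
    have "(\<Sum>b\<in>B. (c * cinner b a) *\<^sub>C b) = (\<Sum>b\<in>B. if b = a then c *\<^sub>C a else 0)"
      using B step.hyps by (intro sum.cong) (auto simp: orthonormal_basis_def)
    also have "\<dots> = c *\<^sub>C a" using fin step.hyps by simp
    finally have "(\<Sum>b\<in>B. (c * cinner b a) *\<^sub>C b) + (\<Sum>b\<in>B. cinner b y *\<^sub>C b) = c *\<^sub>C a + y"
      by (simp only: step.IH[symmetric])
    then show ?case
      by (simp add: cinner_add_right cinner_scaleC_right scaleC_add_left sum.distrib)
  qed
qed

lemma ctrace_eq:
  fixes A :: "'a::complex_inner \<Rightarrow> 'a"
  assumes fd: "finite_dimensional TYPE('a)" and lin: "clinear A" and B: "orthonormal_basis B"
  shows "ctrace A = (\<Sum>b\<in>B. cinner b (A b))"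
proof -
  define C where "C = (SOME B::'a set. orthonormal_basis B)"
  have C: "orthonormal_basis C" unfolding C_def using B by (rule someI)
  note finB = orthonormal_basis_finite[OF fd B] and finC = orthonormal_basis_finite[OF fd C]
  have "cinner c (A c) = (\<Sum>b\<in>B. cinner b c * cinner c (A b))" for c
  proof -
    have "A c = A (\<Sum>b\<in>B. cinner b c *\<^sub>C b)"
      by (rule arg_cong[OF orthonormal_basis_expansion[OF finB B]])
    also have "\<dots> = (\<Sum>b\<in>B. cinner b c *\<^sub>C A b)"
      using lin by (simp add: complex_vector_pair.linear_sum complex_vector_pair.linear_scale)
    finally show ?thesis by (simp add: cinner_sum_right cinner_scaleC_right)
  qed
  then have "(\<Sum>c\<in>C. cinner c (A c)) = (\<Sum>c\<in>C. \<Sum>b\<in>B. cinner b c * cinner c (A b))"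
    by simp
  also have "\<dots> = (\<Sum>b\<in>B. \<Sum>c\<in>C. cinner b c * cinner c (A b))"
    by (rule sum.swap)
  also have "\<dots> = (\<Sum>b\<in>B. cinner b (A b))"
  proof (intro sum.cong refl)
    fix b
    show "(\<Sum>c\<in>C. cinner b c * cinner c (A b)) = cinner b (A b)"
      using arg_cong[OF orthonormal_basis_expansion[OF finC C, of "A b"], of "cinner b"]
      by (simp only: cinner_sum_right cinner_scaleC_right mult.commute)
  qed
  finally show ?thesis unfolding ctrace_def C_def .
qed

definition mutually_unbiased :: "'a::complex_inner set \<Rightarrow> 'a set \<Rightarrow> bool" where
  "mutually_unbiased B C \<longleftrightarrow>
     (\<forall>b\<in>B. \<forall>c\<in>C. cmod (cinner b c) = 1 / sqrt (real (cdim (UNIV :: 'a set))))"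

definition MUBs :: "'a::complex_inner set set \<Rightarrow> bool" where
  "MUBs \<B> \<longleftrightarrow> (\<forall>B\<in>\<B>. orthonormal_basis B) \<and>
     (\<forall>B\<in>\<B>. \<forall>C\<in>\<B>. B \<noteq> C \<longrightarrow> mutually_unbiased B C)"

definition renyi_entropy :: "real \<Rightarrow> 'i set \<Rightarrow> ('i \<Rightarrow> real) \<Rightarrow> real" where
  "renyi_entropy \<alpha> I p = 1 / (1 - \<alpha>) * ln (\<Sum>j\<in>I. p j powr \<alpha>)"

text \<open>\<open>outcome_prob \<rho> b\<close> is \<open>\<langle>b|\<rho>|b\<rangle>\<close>, which is real when \<open>\<rho>\<close> is positive semidefinite.\<close>

definition outcome_prob :: "('a::complex_inner \<Rightarrow> 'a) \<Rightarrow> 'a \<Rightarrow> real" where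
  "outcome_prob \<rho> b = Re (cinner b (\<rho> b))"

definition basis_renyi_entropy :: "real \<Rightarrow> 'a::complex_inner set \<Rightarrow> ('a \<Rightarrow> 'a) \<Rightarrow> real" where
  "basis_renyi_entropy \<alpha> B \<rho> = renyi_entropy \<alpha> B (outcome_prob \<rho>)"

instantiation complex :: complex_inner
begin

definition scaleC_complex :: "complex \<Rightarrow> complex \<Rightarrow> complex" where
  "scaleC_complex c x = c * x"

definition cinner_complex :: "complex \<Rightarrow> complex \<Rightarrow> complex" where
  "cinner_complex x y = cnj x * y"

instance
  by standard (auto simp: scaleC_complex_def cinner_complex_def algebra_simps)

end

instantiation vec :: (complex_inner, finite) complex_inner
begin

definition scaleC_vec :: "complex \<Rightarrow> 'a ^ 'b \<Rightarrow> 'a ^ 'b" where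
  "scaleC_vec c x = (\<chi> i. c *\<^sub>C (x $ i))"

definition cinner_vec :: "'a ^ 'b \<Rightarrow> 'a ^ 'b \<Rightarrow> complex" where
  "cinner_vec x y = (\<Sum>i\<in>UNIV. cinner (x $ i) (y $ i))"

instance
proof
  fix x y z :: "'a ^ 'b" and c c' :: complex
  show "c *\<^sub>C (x + y) = c *\<^sub>C x + c *\<^sub>C y" "(c + c') *\<^sub>C x = c *\<^sub>C x + c' *\<^sub>C x"
    "c *\<^sub>C (c' *\<^sub>C x) = (c * c') *\<^sub>C x" "1 *\<^sub>C x = x"
    by (simp_all add: scaleC_vec_def vec_eq_iff scaleC_add_right scaleC_add_left scaleC_scaleC
        scaleC_one)
  show "cinner x y = cnj (cinner y x)"
    unfolding cinner_vec_def cnj_sum by (rule sum.cong[OF refl], rule cinner_commute)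
  show "cinner x (y + z) = cinner x y + cinner x z"
    by (simp add: cinner_vec_def cinner_add_right sum.distrib)
  show "cinner x (c *\<^sub>C y) = c * cinner x y"
    by (simp add: cinner_vec_def scaleC_vec_def cinner_scaleC_right sum_distrib_left)
  show "0 \<le> Re (cinner x x)"
    by (simp add: cinner_vec_def sum_nonneg cinner_ge_zero)
  assume "cinner x x = 0"
  then have "(\<Sum>i\<in>UNIV. Re (cinner (x $ i) (x $ i))) = 0"
    by (simp add: cinner_vec_def flip: Re_sum)
  then have "Re (cinner (x $ i) (x $ i)) = 0" for i
    by (simp add: sum_nonneg_eq_0_iff cinner_ge_zero)
  moreover have "Im (cinner (x $ i) (x $ i)) = 0" for i
    using arg_cong[OF cinner_commute[of "x $ i" "x $ i"], of Im] by simp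
  ultimately show "x = 0"
    by (simp add: vec_eq_iff cinner_eq_zero complex_eq_iff)
qed

end

end

theory Submission
  imports Defs
begin

text \<open>Write \<open>P\<^sub>b\<close> for the projection onto \<open>b\<close>. In the Hilbert-Schmidt inner product two projections
  from different mutually unbiased bases have inner product \<open>1 / d\<close>, so after subtracting the
  component along the identity the bases span mutually orthogonal spaces of operators. Bessel's
  inequality for \<open>\<rho>\<close> then bounds the sum of all squared outcome probabilities by
  \<open>tr (\<rho>\<^sup>2) + (M - 1) / d\<close>. Each Renyi entropy of order \<open>\<alpha> \<ge> 2\<close> is controlled by the collision
  probability, because the \<open>\<alpha>\<close>-norm is at most the \<open>2\<close>-norm, and concavity of the logarithm
  averages over the bases. The state-independent bound follows from \<open>tr (\<rho>\<^sup>2) \<le> 1\<close>.\<close>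

section \<open>Sesquilinearity and expansions in an orthonormal basis\<close>

lemma cinner_minus_right: "cinner x (- y) = - cinner x y"
  using cinner_add_right[of x y "- y"] by (simp add: cinner_zero_right eq_neg_iff_add_eq_0 add.commute)

lemma cinner_diff_right: "cinner x (y - z) = cinner x y - cinner x z"
  using cinner_add_right[of x y "- z"] by (simp add: cinner_minus_right)

lemma cinner_add_left: "cinner (x + y) z = cinner x z + cinner y z"
  by (metis cinner_add_right cinner_commute complex_cnj_add)

lemma cinner_diff_left: "cinner (x - y) z = cinner x z - cinner y z"
  by (metis cinner_diff_right cinner_commute complex_cnj_diff)

lemma cinner_scaleC_left: "cinner (c *\<^sub>C x) y = cnj c * cinner x y"
  by (metis cinner_scaleC_right cinner_commute complex_cnj_mult)

lemma cinner_sum_left: "cinner (\<Sum>i\<in>I. f i) y = (\<Sum>i\<in>I. cinner (f i) y)"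
  by (subst cinner_commute, subst cinner_sum_right) (simp flip: cinner_commute)

lemma cinner_times_commute: "cinner x y * cinner y x = complex_of_real ((cmod (cinner x y))\<^sup>2)"
  using complex_norm_square[of "cinner x y"] cinner_commute[of y x] by simp

lemma parseval:
  assumes "finite E" "orthonormal_basis E"
  shows "(\<Sum>e\<in>E. cinner x e * cinner e y) = cinner x y"
  using arg_cong[OF orthonormal_basis_expansion[OF assms, of y], of "cinner x"]
  by (simp only: cinner_sum_right cinner_scaleC_right mult.commute)

lemma clinear_basis_expansion:
  assumes "finite E" "orthonormal_basis E" "clinear A"
  shows "A x = (\<Sum>e\<in>E. cinner e x *\<^sub>C A e)"
proof -
  have "A x = A (\<Sum>e\<in>E. cinner e x *\<^sub>C e)"
    by (rule arg_cong[OF orthonormal_basis_expansion[OF assms(1,2)]])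
  then show ?thesis
    using assms(3) by (simp add: complex_vector_pair.linear_sum complex_vector_pair.linear_scale)
qed

section \<open>Bessel's inequality in the Hilbert-Schmidt inner product\<close>

text \<open>The left side is the Hilbert-Schmidt product of the real combination of the rank-one
  operators \<open>|v i><v i|\<close> with \<open>A\<close>, computed in \<open>E\<close>. Summing
  over \<open>E\<close> first reassembles \<open>A (v i)\<close> from its expansion.\<close>

lemma hilbert_schmidt_rank_one_sum:
  assumes E: "finite E" "orthonormal_basis E" and A: "clinear A"
  shows "(\<Sum>e\<in>E. cinner (\<Sum>i\<in>I. (complex_of_real (q i) * cinner (v i) e) *\<^sub>C v i) (A e))
    = (\<Sum>i\<in>I. q i * cinner (v i) (A (v i)))"
proof -
  have "(\<Sum>e\<in>E. cinner (\<Sum>i\<in>I. (complex_of_real (q i) * cinner (v i) e) *\<^sub>C v i) (A e))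
    = (\<Sum>e\<in>E. \<Sum>i\<in>I. q i * (cinner e (v i) * cinner (v i) (A e)))"
    by (simp add: cinner_sum_left cinner_scaleC_left mult.assoc flip: cinner_commute)
  also have "\<dots> = (\<Sum>i\<in>I. q i * (\<Sum>e\<in>E. cinner e (v i) * cinner (v i) (A e)))"
    by (subst sum.swap) (simp add: sum_distrib_left)
  also have "\<dots> = (\<Sum>i\<in>I. q i * cinner (v i) (A (v i)))"
    by (subst (2) clinear_basis_expansion[OF E A])
      (simp add: cinner_sum_right cinner_scaleC_right)
  finally show ?thesis .
qed

text \<open>The right side is the squared Hilbert-Schmidt norm of \<open>A\<close> minus the
  combination of the \<open>|v i><v i|\<close> with weights \<open>q i\<close>. The Gram term stays
  a double sum because vectors of different bases overlap.\<close>

lemma hilbert_schmidt_bessel: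
  fixes q :: "'i \<Rightarrow> real"
  assumes E: "finite E" "orthonormal_basis E" and A: "clinear A"
  shows "0 \<le> (\<Sum>e\<in>E. Re (cinner (A e) (A e))) - 2 * (\<Sum>i\<in>I. q i * Re (cinner (v i) (A (v i))))
    + (\<Sum>i\<in>I. \<Sum>j\<in>I. q i * q j * (cmod (cinner (v i) (v j)))\<^sup>2)"
proof -
  define Y where "Y x = (\<Sum>i\<in>I. (complex_of_real (q i) * cinner (v i) x) *\<^sub>C v i)" for x
  have Y: "clinear Y"
    unfolding Vector_Spaces.linear_iff Y_def
    by (simp add: complex_vector.vector_space_axioms cinner_add_right cinner_scaleC_right
        ring_distribs scaleC_add_left sum.distrib complex_vector.scale_sum_right scaleC_scaleC mult_ac)
  have YA: "(\<Sum>e\<in>E. Re (cinner (Y e) (A e))) = (\<Sum>i\<in>I. q i * Re (cinner (v i) (A (v i))))"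
    using hilbert_schmidt_rank_one_sum[OF E A, of q v I, folded Y_def, THEN arg_cong[of _ _ Re]]
    by simp
  have vYv: "Re (cinner (v i) (Y (v i))) = (\<Sum>j\<in>I. q j * (cmod (cinner (v i) (v j)))\<^sup>2)" for i
  proof -
    have "cinner (v i) (Y (v i)) = (\<Sum>j\<in>I. q j * (cinner (v i) (v j) * cinner (v j) (v i)))"
      by (simp add: Y_def cinner_sum_right cinner_scaleC_right mult_ac)
    then show ?thesis by (simp add: cinner_times_commute)
  qed
  have YY: "(\<Sum>e\<in>E. Re (cinner (Y e) (Y e)))
      = (\<Sum>i\<in>I. \<Sum>j\<in>I. q i * q j * (cmod (cinner (v i) (v j)))\<^sup>2)"
    using hilbert_schmidt_rank_one_sum[OF E Y, of q v I, folded Y_def, THEN arg_cong[of _ _ Re]]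
    by (simp add: vYv sum_distrib_left mult.assoc)
  have "Re (cinner (A e - Y e) (A e - Y e))
      = Re (cinner (A e) (A e)) - 2 * Re (cinner (Y e) (A e)) + Re (cinner (Y e) (Y e))" for e
    using cinner_commute[of "A e" "Y e"] by (simp add: cinner_diff_left cinner_diff_right)
  moreover have "0 \<le> (\<Sum>e\<in>E. Re (cinner (A e - Y e) (A e - Y e)))"
    by (intro sum_nonneg cinner_ge_zero)
  ultimately show ?thesis
    by (simp add: sum.distrib sum_subtractf YA YY flip: sum_distrib_left)
qed

section \<open>Positive semidefinite operators\<close>

text \<open>Polarization: reality of the quadratic form at \<open>x + y\<close> relates the
  imaginary parts of the two off-diagonal entries, and reality at
  \<open>x + \<i> *\<^sub>C y\<close> their real parts.\<close>

lemma positive_semidefinite_hermitian: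
  assumes "positive_semidefinite A"
  shows "cinner x (A y) = cinner (A x) y"
proof -
  have lin: "A (x + y) = A x + A y" "A (c *\<^sub>C y) = c *\<^sub>C A y" for c x y
    using assms unfolding positive_semidefinite_def Vector_Spaces.linear_iff by auto
  have Im0: "Im (cinner x (A x)) = 0" for x
    using assms unfolding positive_semidefinite_def complex_is_Real_iff by auto
  have 1: "Im (cinner x (A y)) + Im (cinner y (A x)) = 0"
    using Im0[of "x + y"] Im0[of x] Im0[of y] by (simp add: lin cinner_add_left cinner_add_right)
  have 2: "Re (cinner x (A y)) - Re (cinner y (A x)) = 0"
    using Im0[of "x + \<i> *\<^sub>C y"] Im0[of x] Im0[of y]
    by (simp add: lin cinner_add_left cinner_add_right cinner_scaleC_left cinner_scaleC_right)
  have "cinner x (A y) = cnj (cinner y (A x))"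
    using 1 2 by (simp add: complex_eq_iff)
  then show ?thesis using cinner_commute[of "A x" y] by simp
qed

lemma quadratic_nonneg_discriminant:
  fixes a b z :: real
  assumes "\<And>s. 0 \<le> a + 2 * s * z + s\<^sup>2 * b" and "0 \<le> b"
  shows "z\<^sup>2 \<le> a * b"
proof (cases "b = 0")
  case True
  have "z = 0"
  proof (rule ccontr)
    assume "z \<noteq> 0"
    \<comment> \<open>With \<open>b = 0\<close> the form is affine in \<open>s\<close>, and this
      \<open>s\<close> gives it the value -1.\<close>
    with assms(1)[of "- (a + 1) / (2 * z)"] True show False by (simp add: field_simps)
  qed
  with True show ?thesis by simp
next
  case False
  with assms(2) have "b > 0" by simp
  \<comment> \<open>The minimiser of the quadratic in \<open>s\<close>.\<close>
  with assms(1)[of "- z / b"] show ?thesis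
    by (simp add: field_simps power2_eq_square)
qed

text \<open>The form \<open>cinner x (A y)\<close> may be degenerate, so the argument goes through
  the discriminant, which also covers a vanishing leading coefficient.\<close>

lemma positive_semidefinite_cauchy_schwarz:
  assumes A: "positive_semidefinite A"
  shows "(cmod (cinner x (A y)))\<^sup>2 \<le> Re (cinner x (A x)) * Re (cinner y (A y))"
proof (rule quadratic_nonneg_discriminant)
  have lin: "A (x + y) = A x + A y" "A (c *\<^sub>C y) = c *\<^sub>C A y" for c x y
    using A unfolding positive_semidefinite_def Vector_Spaces.linear_iff by auto
  show "0 \<le> Re (cinner y (A y))"
    using A unfolding positive_semidefinite_def by auto
  fix s :: real
  define z where "z = cinner x (A y)"
  have yx: "cinner y (A x) = cnj z"
    using positive_semidefinite_hermitian[OF A, of y x] cinner_commute[of "A y" x] z_def by simp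
  \<comment> \<open>the phase \<open>u\<close> turns \<open>z\<close> into its modulus\<close>
  obtain u where u: "u * z = complex_of_real (cmod z)" "cnj u * u = 1"
  proof (cases "z = 0")
    case True then show ?thesis using that[of 1] by simp
  next
    case False
    have "cnj z * z = complex_of_real ((cmod z)\<^sup>2)"
      using complex_norm_square[of z] by (simp add: mult.commute)
    with False show ?thesis
      using that[of "cnj z / complex_of_real (cmod z)"]
      by (simp add: field_simps power2_eq_square)
  qed
  have u': "cnj u * cnj z = complex_of_real (cmod z)"
    using arg_cong[OF u(1), of cnj] by simp
  define w where "w = complex_of_real s * u"
  have "cinner (x + w *\<^sub>C y) (A (x + w *\<^sub>C y))
      = cinner x (A x) + s * (u * z) + s * (cnj u * cnj z) + s\<^sup>2 * (cnj u * u) * cinner y (A y)"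
    by (simp add: lin cinner_add_left cinner_add_right cinner_scaleC_left cinner_scaleC_right w_def
        yx algebra_simps power2_eq_square flip: z_def)
  then have "Re (cinner (x + w *\<^sub>C y) (A (x + w *\<^sub>C y)))
      = Re (cinner x (A x)) + 2 * s * cmod z + s\<^sup>2 * Re (cinner y (A y))"
    unfolding u u' by (simp flip: of_real_power)
  then show "0 \<le> Re (cinner x (A x)) + 2 * s * cmod (cinner x (A y)) + s\<^sup>2 * Re (cinner y (A y))"
    using A unfolding positive_semidefinite_def z_def by metis
qed

section \<open>Outcome probabilities and purity\<close>

lemma sum_outcome_prob:
  fixes \<rho> :: "'a::complex_inner \<Rightarrow> 'a"
  assumes "finite_dimensional TYPE('a)" "density_matrix \<rho>" "orthonormal_basis B"
  shows "(\<Sum>b\<in>B. outcome_prob \<rho> b) = 1"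
  using ctrace_eq[OF assms(1) _ assms(3), of \<rho>] assms(2)
  by (simp add: density_matrix_def positive_semidefinite_def outcome_prob_def flip: Re_sum)

lemma outcome_prob_nonneg: "density_matrix \<rho> \<Longrightarrow> 0 \<le> outcome_prob \<rho> b"
  by (simp add: density_matrix_def positive_semidefinite_def outcome_prob_def)

text \<open>Self-adjointness turns the trace of the square into the squared Hilbert-Schmidt norm,
  the form in which Bessel's inequality uses it.\<close>

lemma purity_eq:
  fixes \<rho> :: "'a::complex_inner \<Rightarrow> 'a"
  assumes fd: "finite_dimensional TYPE('a)" and psd: "positive_semidefinite \<rho>"
    and E: "orthonormal_basis E"
  shows "Re (ctrace (\<rho> \<circ> \<rho>)) = (\<Sum>e\<in>E. Re (cinner (\<rho> e) (\<rho> e)))"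
proof -
  have "clinear (\<rho> \<circ> \<rho>)"
    using psd Vector_Spaces.linear_compose unfolding positive_semidefinite_def by blast
  from ctrace_eq[OF fd this E] show ?thesis
    using positive_semidefinite_hermitian[OF psd] by simp
qed

text \<open>By Cauchy-Schwarz each squared matrix entry is at most the product of the two diagonal
  entries, and these products sum to the squared trace.\<close>

lemma purity_le_one:
  fixes \<rho> :: "'a::complex_inner \<Rightarrow> 'a" and E :: "'a set"
  assumes fd: "finite_dimensional TYPE('a)" and \<rho>: "density_matrix \<rho>" and E: "orthonormal_basis E"
  shows "Re (ctrace (\<rho> \<circ> \<rho>)) \<le> 1"
proof -
  note finE = orthonormal_basis_finite[OF fd E]
  have psd: "positive_semidefinite \<rho>" using \<rho> by (simp add: density_matrix_def)
  have "Re (cinner (\<rho> e) (\<rho> e)) = (\<Sum>f\<in>E. (cmod (cinner f (\<rho> e)))\<^sup>2)" for e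
  proof -
    have "cinner (\<rho> e) (\<rho> e) = (\<Sum>f\<in>E. cinner f (\<rho> e) * cinner (\<rho> e) f)"
      using parseval[OF finE E, of "\<rho> e" "\<rho> e"] by (simp add: mult.commute)
    then show ?thesis by (simp add: cinner_times_commute)
  qed
  then have "Re (ctrace (\<rho> \<circ> \<rho>)) = (\<Sum>e\<in>E. \<Sum>f\<in>E. (cmod (cinner f (\<rho> e)))\<^sup>2)"
    by (simp add: purity_eq[OF fd psd E])
  also have "\<dots> \<le> (\<Sum>e\<in>E. \<Sum>f\<in>E. outcome_prob \<rho> f * outcome_prob \<rho> e)"
    unfolding outcome_prob_def by (intro sum_mono positive_semidefinite_cauchy_schwarz psd)
  also have "\<dots> = 1"
    by (simp add: sum_outcome_prob[OF fd \<rho> E] flip: sum_distrib_left sum_distrib_right)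
  finally show ?thesis .
qed

section \<open>Collision probabilities in mutually unbiased bases\<close>

text \<open>\<open>hilbert_schmidt_bessel\<close> is applied to the vectors of all bases together.
  The weights have the same sum over each basis, so all blocks of the Gram sum between different
  bases are equal.\<close>

lemma MUBs_sum_collision_probability_le:
  fixes \<B> :: "'a::complex_inner set set"
  assumes fd: "finite_dimensional TYPE('a)" and mub: "MUBs \<B>" and fin: "finite \<B>"
    and ne: "\<B> \<noteq> {}" and \<rho>: "density_matrix \<rho>"
  shows "(\<Sum>B\<in>\<B>. \<Sum>b\<in>B. (outcome_prob \<rho> b)\<^sup>2)
    \<le> Re (ctrace (\<rho> \<circ> \<rho>)) + (real (card \<B>) - 1) / real (cdim (UNIV :: 'a set))"
proof -
  define M where "M = real (card \<B>)"
  define d where "d = real (cdim (UNIV :: 'a set))"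
  define p where "p = outcome_prob \<rho>"
  \<comment> \<open>Each basis resolves the identity, so the identity component of \<open>\<rho>\<close> can be spread evenly over
    the bases: \<open>\<Sum>\<^sub>b (p b - t) P\<^sub>b\<close> is the projection of \<open>\<rho>\<close> onto the span of all the \<open>P\<^sub>b\<close>.\<close>
  define t where "t = (M - 1) / (M * d)"
  define q where "q b = p b - t" for b
  have onb: "orthonormal_basis B" if "B \<in> \<B>" for B
    using mub that by (simp add: MUBs_def)
  have finB: "finite B" if "B \<in> \<B>" for B
    using orthonormal_basis_finite[OF fd onb[OF that]] .
  have cardB: "real (card B) = d" if "B \<in> \<B>" for B
    using complex_vector.dim_eq_card[of B UNIV] orthonormal_basis_independent[OF onb[OF that]]
      onb[OF that] unfolding d_def orthonormal_basis_def by simp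
  have sump: "(\<Sum>b\<in>B. p b) = 1" if "B \<in> \<B>" for B
    unfolding p_def by (rule sum_outcome_prob[OF fd \<rho> onb[OF that]])
  obtain E where EB: "E \<in> \<B>" using ne by blast
  \<comment> \<open>Dimension 0 is excluded because the probabilities sum to 1.\<close>
  have "E \<noteq> {}" using sump[OF EB] by auto
  then have d: "d > 0" using cardB[OF EB] finB[OF EB] by (metis card_gt_0_iff of_nat_0_less_iff)
  have M: "M > 0" using fin ne by (simp add: M_def card_gt_0_iff)
  have sumq: "(\<Sum>b\<in>B. q b) = 1 / M" if "B \<in> \<B>" for B
  proof -
    have "(\<Sum>b\<in>B. q b) = 1 - d * t"
      using sump[OF that] cardB[OF that] by (simp add: q_def sum_subtractf)
    then show ?thesis using d M by (simp add: t_def field_simps)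
  qed
  have overlap: "(\<Sum>b\<in>B. \<Sum>c\<in>C. q b * q c * (cmod (cinner b c))\<^sup>2)
      = (if B = C then \<Sum>b\<in>B. (q b)\<^sup>2 else 1 / (M\<^sup>2 * d))" if "B \<in> \<B>" "C \<in> \<B>" for B C
  proof (cases "B = C")
    case True
    have "(\<Sum>c\<in>B. q b * q c * (cmod (cinner b c))\<^sup>2) = (q b)\<^sup>2" if "b \<in> B" for b
    proof -
      have "(\<Sum>c\<in>B. q b * q c * (cmod (cinner b c))\<^sup>2) = (\<Sum>c\<in>B. if b = c then (q b)\<^sup>2 else 0)"
        using onb[OF \<open>B \<in> \<B>\<close>] that
        by (intro sum.cong) (auto simp: orthonormal_basis_def power2_eq_square)
      then show ?thesis using that finB[OF \<open>B \<in> \<B>\<close>] by simp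
    qed
    with True show ?thesis by simp
  next
    case False
    then have "mutually_unbiased B C" using mub that by (simp add: MUBs_def)
    then have "(\<Sum>b\<in>B. \<Sum>c\<in>C. q b * q c * (cmod (cinner b c))\<^sup>2)
        = (\<Sum>b\<in>B. \<Sum>c\<in>C. q b * q c * (1 / d))"
      using d by (intro sum.cong refl)
        (auto simp: mutually_unbiased_def d_def power_divide)
    \<comment> \<open>Constant overlaps make the double sum factor, so only the total weights
      \<open>1 / M\<close> enter.\<close>
    also have "\<dots> = (\<Sum>b\<in>B. q b) * (\<Sum>c\<in>C. q c) * (1 / d)"
      by (simp only: sum_product flip: sum_distrib_right)
    also have "\<dots> = 1 / (M\<^sup>2 * d)" using that by (simp add: sumq power2_eq_square)
    finally show ?thesis using False by simp
  qed
  have "(\<Sum>C\<in>\<B>. if B = C then \<Sum>b\<in>B. (q b)\<^sup>2 else 1 / (M\<^sup>2 * d))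
      = (\<Sum>b\<in>B. (q b)\<^sup>2) + (M - 1) / (M\<^sup>2 * d)" if "B \<in> \<B>" for B
  proof -
    have "(\<Sum>C\<in>\<B> - {B}. if B = C then \<Sum>b\<in>B. (q b)\<^sup>2 else 1 / (M\<^sup>2 * d))
        = (\<Sum>C\<in>\<B> - {B}. 1 / (M\<^sup>2 * d))"
      by (intro sum.cong) auto
    also have "\<dots> = (M - 1) / (M\<^sup>2 * d)"
      using that fin M by (simp add: M_def of_nat_diff Suc_le_eq)
    finally show ?thesis by (subst sum.remove[OF fin that]) simp
  qed
  then have gram: "(\<Sum>B\<in>\<B>. \<Sum>C\<in>\<B>. \<Sum>b\<in>B. \<Sum>c\<in>C. q b * q c * (cmod (cinner b c))\<^sup>2)
      = (\<Sum>B\<in>\<B>. \<Sum>b\<in>B. (q b)\<^sup>2) + (M - 1) / (M * d)"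
    using M by (simp add: overlap sum.distrib M_def[symmetric]) (simp add: power2_eq_square)
  have psd: "positive_semidefinite \<rho>" and lin: "clinear \<rho>"
    using \<rho> by (simp_all add: density_matrix_def positive_semidefinite_def)
  \<comment> \<open>Tagging each vector with its basis lets sums over \<open>I\<close> split
    directly into iterated sums.\<close>
  define I where "I = Sigma \<B> (\<lambda>B. B)"
  have sumI: "(\<Sum>i\<in>I. f (snd i)) = (\<Sum>B\<in>\<B>. \<Sum>b\<in>B. f b)" for f :: "'a \<Rightarrow> real"
    unfolding I_def using fin finB by (subst sum.Sigma) (auto simp: split_def)
  have "(\<Sum>i\<in>I. \<Sum>j\<in>I. q (snd i) * q (snd j) * (cmod (cinner (snd i) (snd j)))\<^sup>2)
      = (\<Sum>B\<in>\<B>. \<Sum>b\<in>B. \<Sum>C\<in>\<B>. \<Sum>c\<in>C. q b * q c * (cmod (cinner b c))\<^sup>2)"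
    by (simp only: sumI[of "\<lambda>c. q b * q c * (cmod (cinner b c))\<^sup>2" for b]
        sumI[of "\<lambda>b. \<Sum>C\<in>\<B>. \<Sum>c\<in>C. q b * q c * (cmod (cinner b c))\<^sup>2"])
  also have "\<dots> = (\<Sum>B\<in>\<B>. \<Sum>C\<in>\<B>. \<Sum>b\<in>B. \<Sum>c\<in>C. q b * q c * (cmod (cinner b c))\<^sup>2)"
    by (intro sum.cong refl sum.swap)
  finally have gramI: "(\<Sum>i\<in>I. \<Sum>j\<in>I. q (snd i) * q (snd j) * (cmod (cinner (snd i) (snd j)))\<^sup>2)
      = (\<Sum>B\<in>\<B>. \<Sum>b\<in>B. (q b)\<^sup>2) + (M - 1) / (M * d)"
    unfolding gram .
  have "0 \<le> Re (ctrace (\<rho> \<circ> \<rho>)) - 2 * (\<Sum>B\<in>\<B>. \<Sum>b\<in>B. q b * p b)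
      + ((\<Sum>B\<in>\<B>. \<Sum>b\<in>B. (q b)\<^sup>2) + (M - 1) / (M * d))"
    using hilbert_schmidt_bessel[OF finB[OF EB] onb[OF EB] lin, where I = I and q = "\<lambda>i. q (snd i)" and v = snd]
    unfolding gramI purity_eq[OF fd psd onb[OF EB]] sumI[symmetric] p_def outcome_prob_def .
  \<comment> \<open>As \<open>q b = p b - t\<close>, the terms linear in \<open>p b\<close>
    cancel.\<close>
  moreover have "(\<Sum>B\<in>\<B>. \<Sum>b\<in>B. (q b)\<^sup>2) - 2 * (\<Sum>B\<in>\<B>. \<Sum>b\<in>B. q b * p b)
      = (\<Sum>B\<in>\<B>. \<Sum>b\<in>B. t\<^sup>2 - (p b)\<^sup>2)"
    unfolding sum_distrib_left sum_subtractf[symmetric]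
    by (intro sum.cong refl) (simp add: q_def power2_eq_square algebra_simps)
  moreover have "(\<Sum>B\<in>\<B>. \<Sum>b\<in>B. t\<^sup>2 - (p b)\<^sup>2) = M * d * t\<^sup>2 - (\<Sum>B\<in>\<B>. \<Sum>b\<in>B. (p b)\<^sup>2)"
    by (simp add: sum_subtractf cardB M_def[symmetric])
  moreover have "M * d * t\<^sup>2 + (M - 1) / (M * d) = (M - 1) / d"
    using M d by (simp add: t_def field_simps power2_eq_square)
  ultimately show ?thesis
    unfolding p_def[symmetric] M_def[symmetric] d_def[symmetric] by linarith
qed

section \<open>From collision probabilities to Renyi entropies\<close>

text \<open>Split off one factor \<open>(p i)\<^sup>2\<close> and bound the remaining power of
  \<open>(p i)\<^sup>2\<close> by that of the whole sum; its exponent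
  \<open>\<alpha> / 2 - 1\<close> is nonnegative.\<close>

lemma sum_powr_le_sum_squares_powr:
  fixes p :: "'i \<Rightarrow> real"
  assumes "finite I" "\<And>i. i \<in> I \<Longrightarrow> 0 \<le> p i" "\<alpha> \<ge> 2"
  shows "(\<Sum>i\<in>I. p i powr \<alpha>) \<le> (\<Sum>i\<in>I. (p i)\<^sup>2) powr (\<alpha> / 2)"
proof -
  define S where "S = (\<Sum>i\<in>I. (p i)\<^sup>2)"
  have "p i powr \<alpha> \<le> (p i)\<^sup>2 * S powr (\<alpha> / 2 - 1)" if i: "i \<in> I" for i
  proof -
    have "(p i)\<^sup>2 \<le> S" unfolding S_def by (rule member_le_sum[OF i]) (use assms in auto)
    have "p i powr \<alpha> = ((p i)\<^sup>2) powr (\<alpha> / 2)"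
      using assms(2)[OF i] by (cases "p i = 0") (simp_all add: powr_powr flip: powr_numeral)
    also have "\<dots> = (p i)\<^sup>2 * ((p i)\<^sup>2) powr (\<alpha> / 2 - 1)"
      by (simp add: powr_mult_base)
    also have "\<dots> \<le> (p i)\<^sup>2 * S powr (\<alpha> / 2 - 1)"
      using \<open>(p i)\<^sup>2 \<le> S\<close> assms(3) by (intro mult_left_mono powr_mono2) auto
    finally show ?thesis .
  qed
  then have "(\<Sum>i\<in>I. p i powr \<alpha>) \<le> (\<Sum>i\<in>I. (p i)\<^sup>2 * S powr (\<alpha> / 2 - 1))"
    by (rule sum_mono)
  also have "\<dots> = S * S powr (\<alpha> / 2 - 1)"
    by (simp add: S_def sum_distrib_right)
  also have "\<dots> = S powr (\<alpha> / 2)"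
    by (subst powr_mult_base) (auto simp: S_def sum_nonneg)
  finally show ?thesis unfolding S_def .
qed

text \<open>The prefactor \<open>1 / (1 - \<alpha>)\<close> is negative, so the upper bound on the
  power sum becomes a lower bound on the entropy. A nonzero entry makes the arguments of both
  logarithms positive.\<close>

lemma renyi_entropy_ge_collision:
  fixes p :: "'i \<Rightarrow> real"
  assumes fin: "finite I" and p: "\<And>i. i \<in> I \<Longrightarrow> 0 \<le> p i" and ex: "\<exists>i\<in>I. p i \<noteq> 0" and \<alpha>: "\<alpha> \<ge> 2"
  shows "\<alpha> / (2 * (\<alpha> - 1)) * - ln (\<Sum>i\<in>I. (p i)\<^sup>2) \<le> renyi_entropy \<alpha> I p"
proof -
  define S where "S = (\<Sum>i\<in>I. (p i)\<^sup>2)"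
  define T where "T = (\<Sum>i\<in>I. p i powr \<alpha>)"
  obtain k where k: "k \<in> I" "p k \<noteq> 0" using ex by blast
  have "S > 0" unfolding S_def by (rule sum_pos2[OF fin k(1)]) (use k in auto)
  have "T > 0" unfolding T_def by (rule sum_pos2[OF fin k(1)]) (use k in auto)
  have "ln T \<le> ln (S powr (\<alpha> / 2))"
    using sum_powr_le_sum_squares_powr[OF fin p \<alpha>] \<open>T > 0\<close> \<open>S > 0\<close>
    by (subst ln_le_cancel_iff) (auto simp: S_def T_def)
  also have "\<dots> = \<alpha> / 2 * ln S" by (simp add: ln_powr)
  finally have "ln T / (\<alpha> - 1) \<le> \<alpha> / 2 * ln S / (\<alpha> - 1)"
    using \<alpha> by (intro divide_right_mono) auto
  moreover have "1 / (1 - \<alpha>) = - (1 / (\<alpha> - 1))"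
    using \<alpha> by (simp add: field_simps)
  ultimately show ?thesis
    by (simp add: renyi_entropy_def flip: S_def T_def)
qed

text \<open>Jensen's inequality for the logarithm, from its tangent line at \<open>K\<close>, where
  \<open>K\<close> is any upper bound on the mean.\<close>

lemma sum_ln_le:
  fixes S :: "'i \<Rightarrow> real"
  assumes "K > 0" "\<And>i. i \<in> I \<Longrightarrow> 0 < S i" "(\<Sum>i\<in>I. S i) \<le> real (card I) * K"
  shows "(\<Sum>i\<in>I. ln (S i)) \<le> real (card I) * ln K"
proof -
  have "ln (S i) \<le> ln K + (S i / K - 1)" if "i \<in> I" for i
    using ln_le_minus_one[of "S i / K"] assms(1) assms(2)[OF that] by (simp add: ln_div)
  then have "(\<Sum>i\<in>I. ln (S i)) \<le> (\<Sum>i\<in>I. ln K + (S i / K - 1))" by (rule sum_mono)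
  also have "\<dots> = real (card I) * ln K + ((\<Sum>i\<in>I. S i) / K - real (card I))"
    by (simp add: sum.distrib sum_subtractf sum_divide_distrib)
  also have "\<dots> \<le> real (card I) * ln K" using assms(1,3) by (simp add: field_simps)
  finally show ?thesis .
qed

section \<open>Averaging the entropies over the bases\<close>

theorem proposition2:
  fixes \<B> :: "'a::complex_inner set set" and \<rho> :: "'a \<Rightarrow> 'a"
    and d M :: nat and \<alpha> :: real
  assumes "finite_dimensional TYPE('a)" and "d = cdim (UNIV :: 'a set)"
    and "MUBs \<B>" and "M = card \<B>" and "M \<ge> 1"
    and "\<alpha> \<ge> 2"
    and "density_matrix \<rho>"
  shows "1 / real M * (\<Sum>B\<in>\<B>. basis_renyi_entropy \<alpha> B \<rho>)
           \<ge> \<alpha> / (2 * (\<alpha> - 1)) *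
               ln (real M * real d / (Re (ctrace (\<rho> \<circ> \<rho>)) * real d + real M - 1))
       \<and> 1 / real M * (\<Sum>B\<in>\<B>. basis_renyi_entropy \<alpha> B \<rho>)
           \<ge> \<alpha> / (2 * (\<alpha> - 1)) * ln (real M * real d / (real d + real M - 1))"
proof -
  note fd = assms(1) and \<rho> = assms(7)
  \<comment> \<open>An infinite set has \<open>card\<close> 0, so \<open>M \<ge> 1\<close> also
    gives finiteness.\<close>
  have fin: "finite \<B>" and ne: "\<B> \<noteq> {}"
    using assms(4,5) by (auto intro: card_ge_0_finite)
  then obtain E where "E \<in> \<B>" by blast
  have onb: "orthonormal_basis B" if "B \<in> \<B>" for B
    using assms(3) that by (simp add: MUBs_def)
  have finB: "finite B" if "B \<in> \<B>" for B
    using orthonormal_basis_finite[OF fd onb[OF that]] .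
  have supp: "\<exists>b\<in>B. outcome_prob \<rho> b \<noteq> 0" if "B \<in> \<B>" for B
    using sum_outcome_prob[OF fd \<rho> onb[OF that]] by (metis sum.neutral zero_neq_one)
  define S where "S B = (\<Sum>b\<in>B. (outcome_prob \<rho> b)\<^sup>2)" for B
  define r where "r = Re (ctrace (\<rho> \<circ> \<rho>))"
  have S_pos: "S B > 0" if B: "B \<in> \<B>" for B
  proof -
    obtain b where b: "b \<in> B" "outcome_prob \<rho> b \<noteq> 0" using supp[OF B] by blast
    show ?thesis unfolding S_def by (rule sum_pos2[OF finB[OF B] b(1)]) (use b in auto)
  qed
  have "E \<noteq> {}" using supp[OF \<open>E \<in> \<B>\<close>] by auto
  moreover have "card E = d"
    using complex_vector.dim_eq_card[of E UNIV] orthonormal_basis_independent[OF onb[OF \<open>E \<in> \<B>\<close>]]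
      onb[OF \<open>E \<in> \<B>\<close>] assms(2) unfolding orthonormal_basis_def by simp
  ultimately have d: "real d > 0" using finB[OF \<open>E \<in> \<B>\<close>] by auto
  have M: "real M > 0" using assms(5) by simp
  have sumS: "(\<Sum>B\<in>\<B>. S B) \<le> r + (real M - 1) / real d"
    using MUBs_sum_collision_probability_le[OF fd assms(3) fin ne \<rho>] assms(2,4)
    by (simp add: S_def r_def)
  define c where "c = \<alpha> / (2 * (\<alpha> - 1))"
  have c: "c > 0" using assms(6) by (simp add: c_def)
  \<comment> \<open>Any upper bound \<open>x\<close> on the purity will do: \<open>x = r\<close>
    yields the state-dependent bound and \<open>x = 1\<close> the state-independent one.\<close>
  have bound: "c * ln (real M * real d / (x * real d + real M - 1))
      \<le> 1 / real M * (\<Sum>B\<in>\<B>. basis_renyi_entropy \<alpha> B \<rho>)" if x: "r \<le> x" for x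
  proof -
    \<comment> \<open>\<open>K\<close> bounds the mean collision probability and is the reciprocal
      of the argument of the logarithm in the claim.\<close>
    define K where "K = (x * real d + real M - 1) / (real M * real d)"
    have MK: "real M * K = x + (real M - 1) / real d"
      using M d by (simp add: K_def field_simps)
    have "(\<Sum>B\<in>\<B>. S B) > 0" using S_pos fin ne by (intro sum_pos) auto
    with sumS x MK M have K: "K > 0" by (smt (verit) zero_less_mult_pos)
    have "(\<Sum>B\<in>\<B>. ln (S B)) \<le> real M * ln K"
      unfolding assms(4) by (rule sum_ln_le) (use K S_pos sumS x MK assms(4) in auto)
    then have "c * - (real M * ln K) \<le> c * - (\<Sum>B\<in>\<B>. ln (S B))"
      using c by simp
    also have "\<dots> = (\<Sum>B\<in>\<B>. c * - ln (S B))"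
      by (simp add: sum_distrib_left sum_negf)
    also have "\<dots> \<le> (\<Sum>B\<in>\<B>. basis_renyi_entropy \<alpha> B \<rho>)"
      unfolding c_def S_def basis_renyi_entropy_def
      by (intro sum_mono renyi_entropy_ge_collision finB outcome_prob_nonneg supp \<rho> assms(6))
    finally have "c * - ln K \<le> 1 / real M * (\<Sum>B\<in>\<B>. basis_renyi_entropy \<alpha> B \<rho>)"
      using M by (simp add: field_simps)
    moreover have "- ln K = ln (real M * real d / (x * real d + real M - 1))"
      using ln_inverse[of K] by (simp add: K_def)
    ultimately show ?thesis by simp
  qed
  have "r \<le> 1" unfolding r_def by (rule purity_le_one[OF fd \<rho> onb[OF \<open>E \<in> \<B>\<close>]])
  with bound[of r] bound[of 1] show ?thesis
    unfolding c_def r_def by simp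
qed

end
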